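(* Let $\mathcal{A}$ be a Hopf algebra with coproduct $\Delta$, and let $$\mathcal{A}_p\subset\mathcal{A}_{p-1}\subset\cdots\subset\mathcal{A}_1\subset\mathcal{A}_0=\mathcal{A}$$ be a sequence of Hopf subalgebras. For each $k=0,1,\dots,p$ let $\mathcal{B}_k\subset\mathcal{A}_k$ be the carrier Hopf subalgebra of a twisting element $\mathcal{F}_{\mathcal{B}_k}\in\mathcal{B}_k\otimes\mathcal{B}_k$. Suppose that, for $k=0,\dots,p-1$, $\mathcal{F}_{\mathcal{B}_k}$ commutes with $\Delta(\mathcal{A}_{k+1})$, i.e. $\mathcal{F}_{\mathcal{B}_k}\Delta(a)=\Delta(a)\mathcal{F}_{\mathcal{B}_k}$ for all $a\in\mathcal{A}_{k+1}$. Then for every $k=0,1,\dots,p$ the product $$\mathcal{F}_{\mathcal{B}_{k\prec 0}}:=\mathcal{F}_{\mathcal{B}_k}\mathcal{F}_{\mathcal{B}_{k-1}}\cdots\mathcal{F}_{\mathcal{B}_0}$$ is a twisting element for $\mathcal{A}$.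
   Context: Let $\mathcal{A}$ be a Hopf algebra with coproduct $\Delta$ and counit $\epsilon$. A twisting element (twist) for $\mathcal{A}$ is an invertible $\mathcal{F}\in\mathcal{A}\otimes\mathcal{A}$ with $$(\epsilon\otimes \mathrm{id})(\mathcal{F})=(\mathrm{id}\otimes\epsilon)(\mathcal{F})=1,\qquad \mathcal{F}_{12}\,(\Delta\otimes \mathrm{id})(\mathcal{F})=\mathcal{F}_{23}\,(\mathrm{id}\otimes\Delta)(\mathcal{F}).$$ A Hopf subalgebra $\mathcal{B}\subset\mathcal{A}$ is a carrier for a twisting element $\mathcal{F}$ if $\mathcal{F}$ is completely defined on $\mathcal{B}$, i.e. $\mathcal{F}\in\mathcal{B}\otimes\mathcal{B}$ is a twisting element of $\mathcal{B}$ (with respect to the original coproduct $\Delta$), and $\mathcal{B}$ is minimal among Hopf subalgebras with this property. *)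

theory Defs
  imports "HOL-Algebra.Free_Abelian_Groups" "HOL-Algebra.Module" "HOL-Algebra.Subrings"
begin

section \<open>Algebras and their tensor products over a field\<close>

text \<open>The library locale \<^locale>\<open>algebra\<close> only covers commutative algebras.\<close>

locale assoc_algebra = K?: field K + module K A + A?: ring A for K and A (structure) +
  assumes smult_mult_left:
      "\<lbrakk>c \<in> carrier K; x \<in> carrier A; y \<in> carrier A\<rbrakk> \<Longrightarrow> (c \<odot>\<^bsub>A\<^esub> x) \<otimes>\<^bsub>A\<^esub> y = c \<odot>\<^bsub>A\<^esub> (x \<otimes>\<^bsub>A\<^esub> y)"
    and smult_mult_right:
      "\<lbrakk>c \<in> carrier K; x \<in> carrier A; y \<in> carrier A\<rbrakk> \<Longrightarrow> x \<otimes>\<^bsub>A\<^esub> (c \<odot>\<^bsub>A\<^esub> y) = c \<odot>\<^bsub>A\<^esub> (x \<otimes>\<^bsub>A\<^esub> y)"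

definition linear_maps :: "('k, 'r) ring_scheme \<Rightarrow> ('k, 'a, 'r1) module_scheme
    \<Rightarrow> ('k, 'b, 'r2) module_scheme \<Rightarrow> ('a \<Rightarrow> 'b) set" where
  "linear_maps K M N = {f \<in> hom (add_monoid M) (add_monoid N).
     \<forall>c\<in>carrier K. \<forall>x\<in>carrier M. f (c \<odot>\<^bsub>M\<^esub> x) = c \<odot>\<^bsub>N\<^esub> f x}"

text \<open>
  The tensor product over \<open>K\<close> is the free Abelian group on pairs modulo the relations that make
  pairs biadditive and \<open>K\<close>-balanced; its elements are cosets.
\<close>

definition tensor_relators :: "('k, 'r) ring_scheme \<Rightarrow> ('k, 'a, 'r1) module_scheme
    \<Rightarrow> ('k, 'b, 'r2) module_scheme \<Rightarrow> ('a \<times> 'b \<Rightarrow>\<^sub>0 int) set" where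
  "tensor_relators K M N =
     {frag_of (x \<oplus>\<^bsub>M\<^esub> x', y) - frag_of (x, y) - frag_of (x', y) | x x' y.
        x \<in> carrier M \<and> x' \<in> carrier M \<and> y \<in> carrier N} \<union>
     {frag_of (x, y \<oplus>\<^bsub>N\<^esub> y') - frag_of (x, y) - frag_of (x, y') | x y y'.
        x \<in> carrier M \<and> y \<in> carrier N \<and> y' \<in> carrier N} \<union>
     {frag_of (c \<odot>\<^bsub>M\<^esub> x, y) - frag_of (x, c \<odot>\<^bsub>N\<^esub> y) | c x y.
        c \<in> carrier K \<and> x \<in> carrier M \<and> y \<in> carrier N}"

definition tensor_null :: "('k, 'r) ring_scheme \<Rightarrow> ('k, 'a, 'r1) module_scheme
    \<Rightarrow> ('k, 'b, 'r2) module_scheme \<Rightarrow> ('a \<times> 'b \<Rightarrow>\<^sub>0 int) set" where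
  "tensor_null K M N =
     generate (free_Abelian_group (carrier M \<times> carrier N)) (tensor_relators K M N)"

definition tensor_group :: "('k, 'r) ring_scheme \<Rightarrow> ('k, 'a, 'r1) module_scheme
    \<Rightarrow> ('k, 'b, 'r2) module_scheme \<Rightarrow> ('a \<times> 'b \<Rightarrow>\<^sub>0 int) set monoid" where
  "tensor_group K M N = free_Abelian_group (carrier M \<times> carrier N) Mod tensor_null K M N"

definition pure_tensor :: "('k, 'r) ring_scheme \<Rightarrow> ('k, 'a, 'r1) module_scheme
    \<Rightarrow> ('k, 'b, 'r2) module_scheme \<Rightarrow> 'a \<Rightarrow> 'b \<Rightarrow> ('a \<times> 'b \<Rightarrow>\<^sub>0 int) set" where
  "pure_tensor K M N x y =
     tensor_null K M N #>\<^bsub>free_Abelian_group (carrier M \<times> carrier N)\<^esub> frag_of (x, y)"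

text \<open>
  The map into a commutative group \<open>G\<close> (written multiplicatively) induced by a biadditive balanced
  map \<open>f\<close>: it sends \<open>x \<otimes> y\<close> to \<open>f x y\<close>; see \<open>tensor_lift_hom\<close> and \<open>tensor_lift_pure\<close> below.
\<close>

definition tensor_lift :: "('c, 'r) monoid_scheme \<Rightarrow> ('a \<Rightarrow> 'b \<Rightarrow> 'c)
    \<Rightarrow> ('a \<times> 'b \<Rightarrow>\<^sub>0 int) set \<Rightarrow> 'c" where
  "tensor_lift G f X = the_elem
     ((\<lambda>t. finprod G (\<lambda>(x, y). f x y [^]\<^bsub>G\<^esub> Poly_Mapping.lookup t (x, y)) (Poly_Mapping.keys t)) ` X)"

text \<open>The universal property, confirming that \<open>tensor_lift\<close> is the induced homomorphism.\<close>

definition balanced :: "('k, 'r) ring_scheme \<Rightarrow> ('k, 'a, 'r1) module_scheme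
    \<Rightarrow> ('k, 'b, 'r2) module_scheme \<Rightarrow> ('c, 'r3) monoid_scheme \<Rightarrow> ('a \<Rightarrow> 'b \<Rightarrow> 'c) \<Rightarrow> bool" where
  "balanced K M N G f \<longleftrightarrow>
     (\<forall>x\<in>carrier M. \<forall>y\<in>carrier N. f x y \<in> carrier G) \<and>
     (\<forall>x\<in>carrier M. \<forall>x'\<in>carrier M. \<forall>y\<in>carrier N. f (x \<oplus>\<^bsub>M\<^esub> x') y = f x y \<otimes>\<^bsub>G\<^esub> f x' y) \<and>
     (\<forall>x\<in>carrier M. \<forall>y\<in>carrier N. \<forall>y'\<in>carrier N. f x (y \<oplus>\<^bsub>N\<^esub> y') = f x y \<otimes>\<^bsub>G\<^esub> f x y') \<and>
     (\<forall>c\<in>carrier K. \<forall>x\<in>carrier M. \<forall>y\<in>carrier N. f (c \<odot>\<^bsub>M\<^esub> x) y = f x (c \<odot>\<^bsub>N\<^esub> y))"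

lemma tensor_relators_subset:
  assumes "module K M" "module K N"
  shows "tensor_relators K M N \<subseteq> carrier (free_Abelian_group (carrier M \<times> carrier N))"
proof -
  interpret M: module K M by fact
  interpret N: module K N by fact
  have d: "a - b \<in> carrier (free_Abelian_group S)"
    if "a \<in> carrier (free_Abelian_group S)" "b \<in> carrier (free_Abelian_group S)"
    for a b :: "'x \<Rightarrow>\<^sub>0 int" and S
    using that keys_diff[of a b] by auto
  show ?thesis
    unfolding tensor_relators_def by (auto simp del: carrier_free_Abelian_group_iff intro!: d)
qed

lemma tensor_null_normal:
  assumes "module K M" "module K N"
  shows "tensor_null K M N \<lhd> free_Abelian_group (carrier M \<times> carrier N)"
  unfolding tensor_null_def
  using tensor_relators_subset[OF assms]
  by (intro comm_group.normal_iff_subgroup[THEN iffD2] abelian_free_Abelian_group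
      group.generate_is_subgroup group_free_Abelian_group)

lemma tensor_lift_aux:
  assumes "module K M" "module K N" "comm_group G" "balanced K M N G f"
  shows "tensor_lift G f \<in> hom (tensor_group K M N) G \<and>
    (\<forall>x\<in>carrier M. \<forall>y\<in>carrier N. tensor_lift G f (pure_tensor K M N x y) = f x y)"
proof -
  interpret M: module K M by fact
  interpret N: module K N by fact
  interpret G: comm_group G by fact
  let ?S = "carrier M \<times> carrier N"
  let ?Z = "free_Abelian_group ?S"
  let ?N = "tensor_null K M N"
  define e where "e = (\<lambda>t :: _ \<Rightarrow>\<^sub>0 int.
    finprod G (\<lambda>(x, y). f x y [^]\<^bsub>G\<^esub> Poly_Mapping.lookup t (x, y)) (Poly_Mapping.keys t))"
  interpret Z: comm_group ?Z by (rule abelian_free_Abelian_group)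
  interpret N: normal ?N ?Z by (rule tensor_null_normal) fact+
  have fc: "f x y \<in> carrier G" if "x \<in> carrier M" "y \<in> carrier N" for x y
    using assms(4) that by (auto simp: balanced_def)
  have e_eq: "e t = finprod G (\<lambda>(x, y). f x y [^]\<^bsub>G\<^esub> Poly_Mapping.lookup t (x, y)) T"
    if "Poly_Mapping.keys t \<subseteq> T" "finite T" "T \<subseteq> ?S" for t :: "_ \<Rightarrow>\<^sub>0 int" and T
    using that fc unfolding e_def
    by (intro G.finprod_mono_neutral_cong_left) (auto simp: in_keys_iff intro!: G.int_pow_closed dest: subsetD)
  have hom: "e \<in> hom ?Z G"
  proof (rule homI)
    fix t assume "t \<in> carrier ?Z"
    then show "e t \<in> carrier G" using fc by (auto simp: e_def intro!: G.finprod_closed)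
  next
    fix t u assume tu: "t \<in> carrier ?Z" "u \<in> carrier ?Z"
    let ?T = "Poly_Mapping.keys t \<union> Poly_Mapping.keys u"
    have "e (t + u) = finprod G (\<lambda>(x, y). f x y [^]\<^bsub>G\<^esub> Poly_Mapping.lookup (t + u) (x, y)) ?T"
      using tu Poly_Mapping.keys_add[of t u] by (intro e_eq) auto
    also have "\<dots> = finprod G (\<lambda>p. (\<lambda>(x, y). f x y [^]\<^bsub>G\<^esub> Poly_Mapping.lookup t (x, y)) p
        \<otimes>\<^bsub>G\<^esub> (\<lambda>(x, y). f x y [^]\<^bsub>G\<^esub> Poly_Mapping.lookup u (x, y)) p) ?T"
      using tu fc by (intro G.finprod_cong')
        (auto simp: Poly_Mapping.lookup_add G.int_pow_mult Pi_iff subset_iff)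
    also have "\<dots> = finprod G (\<lambda>(x, y). f x y [^]\<^bsub>G\<^esub> Poly_Mapping.lookup t (x, y)) ?T
        \<otimes>\<^bsub>G\<^esub> finprod G (\<lambda>(x, y). f x y [^]\<^bsub>G\<^esub> Poly_Mapping.lookup u (x, y)) ?T"
      using tu fc by (intro G.finprod_multf) auto
    also have "\<dots> = e t \<otimes>\<^bsub>G\<^esub> e u"
      using tu by (intro arg_cong2[where f = "monoid.mult G"] e_eq[symmetric]) auto
    finally show "e (t \<otimes>\<^bsub>?Z\<^esub> u) = e t \<otimes>\<^bsub>G\<^esub> e u" by simp
  qed
  interpret E: group_hom ?Z G e
    using hom by unfold_locales
  have e_frag: "e (frag_of (x, y)) = f x y" if "x \<in> carrier M" "y \<in> carrier N" for x y
    using fc[OF that] by (simp add: e_def G.finprod_singleton)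
  have rel: "e r = \<one>\<^bsub>G\<^esub>" if r: "r \<in> tensor_relators K M N" for r
  proof -
    have diff: "e (a - b) = e a \<otimes>\<^bsub>G\<^esub> inv\<^bsub>G\<^esub> e b"
      if "a \<in> carrier ?Z" "b \<in> carrier ?Z" for a b
    proof -
      have "a - b = a \<otimes>\<^bsub>?Z\<^esub> inv\<^bsub>?Z\<^esub> b" using that by simp
      then show ?thesis using that by (simp only: E.hom_mult E.hom_inv Z.inv_closed)
    qed
    have d: "a - b \<in> carrier ?Z" if "a \<in> carrier ?Z" "b \<in> carrier ?Z" for a b
      using that keys_diff[of a b] by auto
    have fz: "frag_of (x, y) \<in> carrier ?Z" if "x \<in> carrier M" "y \<in> carrier N" for x y
      using that by simp
    have cancel: "a \<otimes>\<^bsub>G\<^esub> b \<otimes>\<^bsub>G\<^esub> inv\<^bsub>G\<^esub> a \<otimes>\<^bsub>G\<^esub> inv\<^bsub>G\<^esub> b = \<one>\<^bsub>G\<^esub>"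
      if "a \<in> carrier G" "b \<in> carrier G" for a b
    proof -
      have "a \<otimes>\<^bsub>G\<^esub> b \<otimes>\<^bsub>G\<^esub> inv\<^bsub>G\<^esub> a = b"
        using that by (simp add: G.m_comm[of a b] G.m_assoc)
      then show ?thesis using that by simp
    qed
    from r consider
        (1) x x' y where "r = frag_of (x \<oplus>\<^bsub>M\<^esub> x', y) - frag_of (x, y) - frag_of (x', y)"
          "x \<in> carrier M" "x' \<in> carrier M" "y \<in> carrier N"
      | (2) x y y' where "r = frag_of (x, y \<oplus>\<^bsub>N\<^esub> y') - frag_of (x, y) - frag_of (x, y')"
          "x \<in> carrier M" "y \<in> carrier N" "y' \<in> carrier N"
      | (3) c x y where "r = frag_of (c \<odot>\<^bsub>M\<^esub> x, y) - frag_of (x, c \<odot>\<^bsub>N\<^esub> y)"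
          "c \<in> carrier K" "x \<in> carrier M" "y \<in> carrier N"
      unfolding tensor_relators_def by blast
    then show ?thesis
    proof cases
      case 1
      then have "f (x \<oplus>\<^bsub>M\<^esub> x') y = f x y \<otimes>\<^bsub>G\<^esub> f x' y" using assms(4) by (simp add: balanced_def)
      moreover have "e r = f (x \<oplus>\<^bsub>M\<^esub> x') y \<otimes>\<^bsub>G\<^esub> inv\<^bsub>G\<^esub> f x y \<otimes>\<^bsub>G\<^esub> inv\<^bsub>G\<^esub> f x' y"
        unfolding 1(1) by (simp only: diff d fz e_frag 1 M.add.m_closed)
      ultimately show ?thesis using 1 fc
        by (simp add: cancel)
    next
      case 2
      then have "f x (y \<oplus>\<^bsub>N\<^esub> y') = f x y \<otimes>\<^bsub>G\<^esub> f x y'" using assms(4) by (simp add: balanced_def)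
      moreover have "e r = f x (y \<oplus>\<^bsub>N\<^esub> y') \<otimes>\<^bsub>G\<^esub> inv\<^bsub>G\<^esub> f x y \<otimes>\<^bsub>G\<^esub> inv\<^bsub>G\<^esub> f x y'"
        unfolding 2(1) by (simp only: diff d fz e_frag 2 N.add.m_closed)
      ultimately show ?thesis using 2 fc
        by (simp add: cancel)
    next
      case 3
      then have "f (c \<odot>\<^bsub>M\<^esub> x) y = f x (c \<odot>\<^bsub>N\<^esub> y)" using assms(4) by (simp add: balanced_def)
      moreover have "e r = f (c \<odot>\<^bsub>M\<^esub> x) y \<otimes>\<^bsub>G\<^esub> inv\<^bsub>G\<^esub> f x (c \<odot>\<^bsub>N\<^esub> y)"
        unfolding 3(1) by (simp only: diff d fz e_frag 3 M.smult_closed N.smult_closed)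
      ultimately show ?thesis using 3 fc by simp
    qed
  qed
  have "?N \<subseteq> kernel ?Z G e"
    unfolding tensor_null_def
    using rel tensor_relators_subset[OF assms(1,2)]
    by (intro Z.generate_subgroup_incl E.subgroup_kernel)
      (auto simp: kernel_def simp del: carrier_free_Abelian_group_iff)
  then have null: "e n = \<one>\<^bsub>G\<^esub>" if "n \<in> ?N" for n
    using that by (auto simp: kernel_def)
  have img: "tensor_lift G f (?N #>\<^bsub>?Z\<^esub> t) = e t" if t: "t \<in> carrier ?Z" for t
  proof -
    have eq: "e (n \<otimes>\<^bsub>?Z\<^esub> t) = e t" if "n \<in> ?N" for n
      using E.hom_mult[OF N.mem_carrier[OF that] t] null[OF that] E.hom_closed[OF t]
      by simp
    have "e ` (?N #>\<^bsub>?Z\<^esub> t) = {e t}"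
    proof (intro equalityI subsetI)
      fix v assume "v \<in> e ` (?N #>\<^bsub>?Z\<^esub> t)"
      then obtain n where "n \<in> ?N" "v = e (n \<otimes>\<^bsub>?Z\<^esub> t)"
        unfolding r_coset_def by blast
      with eq show "v \<in> {e t}" by blast
    next
      fix v assume "v \<in> {e t}"
      then show "v \<in> e ` (?N #>\<^bsub>?Z\<^esub> t)"
        using Z.rcos_self[OF t N.is_subgroup] by blast
    qed
    then show ?thesis unfolding tensor_lift_def e_def[symmetric] by simp
  qed
  have "tensor_lift G f \<in> hom (tensor_group K M N) G"
  proof (rule homI)
    fix X assume "X \<in> carrier (tensor_group K M N)"
    then obtain t where "t \<in> carrier ?Z" "X = ?N #>\<^bsub>?Z\<^esub> t"
      unfolding tensor_group_def carrier_FactGroup by blast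
    then show "tensor_lift G f X \<in> carrier G" by (simp only: img E.hom_closed)
  next
    fix X Y assume "X \<in> carrier (tensor_group K M N)" "Y \<in> carrier (tensor_group K M N)"
    then obtain t u where tu: "t \<in> carrier ?Z" "X = ?N #>\<^bsub>?Z\<^esub> t" "u \<in> carrier ?Z" "Y = ?N #>\<^bsub>?Z\<^esub> u"
      unfolding tensor_group_def carrier_FactGroup by blast
    then have "X \<otimes>\<^bsub>tensor_group K M N\<^esub> Y = ?N #>\<^bsub>?Z\<^esub> (t \<otimes>\<^bsub>?Z\<^esub> u)"
      unfolding tensor_group_def mult_FactGroup by (simp only: N.rcos_sum)
    then show "tensor_lift G f (X \<otimes>\<^bsub>tensor_group K M N\<^esub> Y) = tensor_lift G f X \<otimes>\<^bsub>G\<^esub> tensor_lift G f Y"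
      using tu by (simp only: img E.hom_mult Z.m_closed)
  qed
  moreover have "tensor_lift G f (pure_tensor K M N x y) = f x y"
    if "x \<in> carrier M" "y \<in> carrier N" for x y
    unfolding pure_tensor_def using img[of "frag_of (x, y)"] e_frag[OF that] that by simp
  ultimately show ?thesis by blast
qed

lemmas tensor_lift_hom = tensor_lift_aux[THEN conjunct1]
lemmas tensor_lift_pure = tensor_lift_aux[THEN conjunct2, rule_format]

definition tensor :: "('k, 'r) ring_scheme \<Rightarrow> ('k, 'a, 'r1) module_scheme
    \<Rightarrow> ('k, 'b, 'r2) module_scheme \<Rightarrow> ('k, ('a \<times> 'b \<Rightarrow>\<^sub>0 int) set) module" where
  "tensor K A B =
    \<lparr> carrier = carrier (tensor_group K A B),
      mult = (\<lambda>X Y. tensor_lift (tensor_group K A B) (\<lambda>a b.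
                tensor_lift (tensor_group K A B) (\<lambda>a' b'.
                  pure_tensor K A B (a \<otimes>\<^bsub>A\<^esub> a') (b \<otimes>\<^bsub>B\<^esub> b')) Y) X),
      one = pure_tensor K A B \<one>\<^bsub>A\<^esub> \<one>\<^bsub>B\<^esub>,
      zero = \<one>\<^bsub>tensor_group K A B\<^esub>,
      add = monoid.mult (tensor_group K A B),
      smult = (\<lambda>c. tensor_lift (tensor_group K A B) (\<lambda>a b. pure_tensor K A B (c \<odot>\<^bsub>A\<^esub> a) b)) \<rparr>"

text \<open>
  For subspaces \<open>S\<close> and \<open>T\<close>, the image of \<open>S \<otimes> T\<close> in \<open>A \<otimes> B\<close>. Over a field the canonical map is
  injective, so this is \<open>S \<otimes> T\<close> itself.
\<close>

definition tensor_subspace :: "('k, 'r) ring_scheme \<Rightarrow> ('k, 'a, 'r1) module_scheme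
    \<Rightarrow> ('k, 'b, 'r2) module_scheme \<Rightarrow> 'a set \<Rightarrow> 'b set \<Rightarrow> ('a \<times> 'b \<Rightarrow>\<^sub>0 int) set set" where
  "tensor_subspace K A B S T =
     generate (tensor_group K A B) {pure_tensor K A B s t | s t. s \<in> S \<and> t \<in> T}"


section \<open>Hopf algebras\<close>

record ('k, 'a) hopf = "('k, 'a) module" +
  comult :: "'a \<Rightarrow> ('a \<times> 'a \<Rightarrow>\<^sub>0 int) set"
  counit :: "'a \<Rightarrow> 'k"
  antipode :: "'a \<Rightarrow> 'a"

abbreviation tensor2 :: "('k, 'r) ring_scheme \<Rightarrow> ('k, 'a, 's) hopf_scheme
    \<Rightarrow> ('k, ('a \<times> 'a \<Rightarrow>\<^sub>0 int) set) module" where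
  "tensor2 K H \<equiv> tensor K H H"

abbreviation tensor3 :: "('k, 'r) ring_scheme \<Rightarrow> ('k, 'a, 's) hopf_scheme
    \<Rightarrow> ('k, ('a \<times> ('a \<times> 'a \<Rightarrow>\<^sub>0 int) set \<Rightarrow>\<^sub>0 int) set) module" where
  "tensor3 K H \<equiv> tensor K H (tensor2 K H)"

abbreviation pure2 :: "('k, 'r) ring_scheme \<Rightarrow> ('k, 'a, 's) hopf_scheme
    \<Rightarrow> 'a \<Rightarrow> 'a \<Rightarrow> ('a \<times> 'a \<Rightarrow>\<^sub>0 int) set" where
  "pure2 K H \<equiv> pure_tensor K H H"

abbreviation pure3 :: "('k, 'r) ring_scheme \<Rightarrow> ('k, 'a, 's) hopf_scheme
    \<Rightarrow> 'a \<Rightarrow> 'a \<Rightarrow> 'a \<Rightarrow> ('a \<times> ('a \<times> 'a \<Rightarrow>\<^sub>0 int) set \<Rightarrow>\<^sub>0 int) set" where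
  "pure3 K H a b c \<equiv> pure_tensor K H (tensor2 K H) a (pure2 K H b c)"

text \<open>\<open>tensor2_12 t = t \<otimes> 1\<close> and \<open>tensor2_23 t = 1 \<otimes> t\<close> in the threefold tensor product.\<close>

definition tensor2_12 :: "('k, 'r) ring_scheme \<Rightarrow> ('k, 'a, 's) hopf_scheme
    \<Rightarrow> ('a \<times> 'a \<Rightarrow>\<^sub>0 int) set \<Rightarrow> ('a \<times> ('a \<times> 'a \<Rightarrow>\<^sub>0 int) set \<Rightarrow>\<^sub>0 int) set" where
  "tensor2_12 K H = tensor_lift (add_monoid (tensor3 K H)) (\<lambda>a b. pure3 K H a b \<one>\<^bsub>H\<^esub>)"

definition tensor2_23 :: "('k, 'r) ring_scheme \<Rightarrow> ('k, 'a, 's) hopf_scheme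
    \<Rightarrow> ('a \<times> 'a \<Rightarrow>\<^sub>0 int) set \<Rightarrow> ('a \<times> ('a \<times> 'a \<Rightarrow>\<^sub>0 int) set \<Rightarrow>\<^sub>0 int) set" where
  "tensor2_23 K H = tensor_lift (add_monoid (tensor3 K H)) (\<lambda>a b. pure3 K H \<one>\<^bsub>H\<^esub> a b)"

text \<open>The maps \<open>\<Delta> \<otimes> id\<close>, \<open>id \<otimes> \<Delta>\<close>, \<open>\<epsilon> \<otimes> id\<close> and \<open>id \<otimes> \<epsilon>\<close>, up to the canonical isomorphisms
  \<open>(H \<otimes> H) \<otimes> H \<cong> H \<otimes> (H \<otimes> H)\<close> and \<open>K \<otimes> H \<cong> H \<cong> H \<otimes> K\<close>.\<close>

definition comult_id :: "('k, 'r) ring_scheme \<Rightarrow> ('k, 'a, 's) hopf_scheme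
    \<Rightarrow> ('a \<times> 'a \<Rightarrow>\<^sub>0 int) set \<Rightarrow> ('a \<times> ('a \<times> 'a \<Rightarrow>\<^sub>0 int) set \<Rightarrow>\<^sub>0 int) set" where
  "comult_id K H = tensor_lift (add_monoid (tensor3 K H)) (\<lambda>a b.
     tensor_lift (add_monoid (tensor3 K H)) (\<lambda>a1 a2. pure3 K H a1 a2 b) (comult H a))"

definition id_comult :: "('k, 'r) ring_scheme \<Rightarrow> ('k, 'a, 's) hopf_scheme
    \<Rightarrow> ('a \<times> 'a \<Rightarrow>\<^sub>0 int) set \<Rightarrow> ('a \<times> ('a \<times> 'a \<Rightarrow>\<^sub>0 int) set \<Rightarrow>\<^sub>0 int) set" where
  "id_comult K H = tensor_lift (add_monoid (tensor3 K H)) (\<lambda>a b.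
     pure_tensor K H (tensor2 K H) a (comult H b))"

definition counit_id :: "('k, 'a, 's) hopf_scheme \<Rightarrow> ('a \<times> 'a \<Rightarrow>\<^sub>0 int) set \<Rightarrow> 'a" where
  "counit_id H = tensor_lift (add_monoid H) (\<lambda>a b. counit H a \<odot>\<^bsub>H\<^esub> b)"

definition id_counit :: "('k, 'a, 's) hopf_scheme \<Rightarrow> ('a \<times> 'a \<Rightarrow>\<^sub>0 int) set \<Rightarrow> 'a" where
  "id_counit H = tensor_lift (add_monoid H) (\<lambda>a b. counit H b \<odot>\<^bsub>H\<^esub> a)"

locale hopf_algebra = assoc_algebra K H
  for K :: "('k, 'r) ring_scheme" and H :: "('k, 'a, 's) hopf_scheme" (structure) +
  assumes comult_ring_hom: "comult H \<in> ring_hom H (tensor2 K H)"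
    and comult_linear: "comult H \<in> linear_maps K H (tensor2 K H)"
    and counit_ring_hom: "counit H \<in> ring_hom H K"
    and counit_smult:
      "\<lbrakk>c \<in> carrier K; a \<in> carrier H\<rbrakk> \<Longrightarrow> counit H (c \<odot>\<^bsub>H\<^esub> a) = c \<otimes>\<^bsub>K\<^esub> counit H a"
    and coassoc:
      "a \<in> carrier H \<Longrightarrow> comult_id K H (comult H a) = id_comult K H (comult H a)"
    and counit_left: "a \<in> carrier H \<Longrightarrow> counit_id H (comult H a) = a"
    and counit_right: "a \<in> carrier H \<Longrightarrow> id_counit H (comult H a) = a"
    and antipode_linear: "antipode H \<in> linear_maps K H H"
    and antipode_left: "a \<in> carrier H \<Longrightarrow>
      tensor_lift (add_monoid H) (\<lambda>x y. antipode H x \<otimes>\<^bsub>H\<^esub> y) (comult H a) = counit H a \<odot>\<^bsub>H\<^esub> \<one>\<^bsub>H\<^esub>"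
    and antipode_right: "a \<in> carrier H \<Longrightarrow>
      tensor_lift (add_monoid H) (\<lambda>x y. x \<otimes>\<^bsub>H\<^esub> antipode H y) (comult H a) = counit H a \<odot>\<^bsub>H\<^esub> \<one>\<^bsub>H\<^esub>"

definition hopf_subalgebra :: "('k, 'r) ring_scheme \<Rightarrow> ('k, 'a, 's) hopf_scheme \<Rightarrow> 'a set \<Rightarrow> bool" where
  "hopf_subalgebra K H B \<longleftrightarrow>
     subring B H \<and>
     (\<forall>c\<in>carrier K. \<forall>b\<in>B. c \<odot>\<^bsub>H\<^esub> b \<in> B) \<and>
     (\<forall>b\<in>B. comult H b \<in> tensor_subspace K H H B B) \<and>
     (\<forall>b\<in>B. antipode H b \<in> B)"


section \<open>Twisting elements\<close>

definition twist_equations :: "('k, 'r) ring_scheme \<Rightarrow> ('k, 'a, 's) hopf_scheme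
    \<Rightarrow> ('a \<times> 'a \<Rightarrow>\<^sub>0 int) set \<Rightarrow> bool" where
  "twist_equations K H F \<longleftrightarrow>
     counit_id H F = \<one>\<^bsub>H\<^esub> \<and>
     id_counit H F = \<one>\<^bsub>H\<^esub> \<and>
     tensor2_12 K H F \<otimes>\<^bsub>tensor3 K H\<^esub> comult_id K H F
       = tensor2_23 K H F \<otimes>\<^bsub>tensor3 K H\<^esub> id_comult K H F"

definition twisting_element :: "('k, 'r) ring_scheme \<Rightarrow> ('k, 'a, 's) hopf_scheme
    \<Rightarrow> ('a \<times> 'a \<Rightarrow>\<^sub>0 int) set \<Rightarrow> bool" where
  "twisting_element K H F \<longleftrightarrow> F \<in> Units (tensor2 K H) \<and> twist_equations K H F"

text \<open>
  Twisting elements of a Hopf subalgebra \<open>B\<close>: both \<open>F\<close> and its inverse lie in \<open>B \<otimes> B\<close>. The equations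
  may be read in \<open>H\<close> and \<open>H \<otimes> H \<otimes> H\<close>, because \<open>B \<otimes> B \<otimes> B\<close> embeds in \<open>H \<otimes> H \<otimes> H\<close> and the
  structure maps of \<open>B\<close> are those of \<open>H\<close>.
\<close>

definition twisting_element_of_sub :: "('k, 'r) ring_scheme \<Rightarrow> ('k, 'a, 's) hopf_scheme
    \<Rightarrow> 'a set \<Rightarrow> ('a \<times> 'a \<Rightarrow>\<^sub>0 int) set \<Rightarrow> bool" where
  "twisting_element_of_sub K H B F \<longleftrightarrow>
     F \<in> Units ((tensor2 K H)\<lparr>carrier := tensor_subspace K H H B B\<rparr>) \<and> twist_equations K H F"

definition carrier_of_twist :: "('k, 'r) ring_scheme \<Rightarrow> ('k, 'a, 's) hopf_scheme
    \<Rightarrow> 'a set \<Rightarrow> ('a \<times> 'a \<Rightarrow>\<^sub>0 int) set \<Rightarrow> bool" where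
  "carrier_of_twist K H B F \<longleftrightarrow>
     hopf_subalgebra K H B \<and> twisting_element_of_sub K H B F \<and>
     (\<forall>C. hopf_subalgebra K H C \<and> twisting_element_of_sub K H C F \<and> C \<subseteq> B \<longrightarrow> C = B)"

text \<open>\<open>twist_product K H F k = F k \<otimes> \<dots> \<otimes> F 1 \<otimes> F 0\<close> in the algebra \<open>H \<otimes> H\<close>.\<close>

primrec twist_product :: "('k, 'r) ring_scheme \<Rightarrow> ('k, 'a, 's) hopf_scheme
    \<Rightarrow> (nat \<Rightarrow> ('a \<times> 'a \<Rightarrow>\<^sub>0 int) set) \<Rightarrow> nat \<Rightarrow> ('a \<times> 'a \<Rightarrow>\<^sub>0 int) set" where
  "twist_product K H F 0 = F 0"
| "twist_product K H F (Suc k) = F (Suc k) \<otimes>\<^bsub>tensor2 K H\<^esub> twist_product K H F k"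

end

theory Submission
  imports Defs
begin

text \<open>
  Suppose \<open>G\<close> is a twist commuting with \<open>\<Delta>(S)\<close> and \<open>F \<in> S \<otimes> S\<close> is a twist. Then \<open>G\<^sub>1\<^sub>2\<close> commutes with
  \<open>(\<Delta> \<otimes> id)(F)\<close> and \<open>G\<^sub>2\<^sub>3\<close> with \<open>(id \<otimes> \<Delta>)(F)\<close>, so the cocycle equation of \<open>F G\<close> factors into those
  of \<open>F\<close> and \<open>G\<close>. The partial product up to \<open>k\<close> commutes with \<open>\<Delta>(A\<^sub>k\<^sub>+\<^sub>1)\<close> because each factor does
  and the \<open>A\<^sub>j\<close> decrease, which gives the induction.
\<close>

subsection \<open>Tensor products of modules\<close>

text \<open>\<open>tensor_lift\<close> reads only the carrier, product and unit of its target, and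
  these agree in both records. This links the lifts inside the definition of \<open>tensor\<close>
  to the lifts into \<open>add_monoid\<close> used everywhere else.\<close>

lemma tensor_lift_tensor_group:
  "tensor_lift (tensor_group K M N) f = tensor_lift (add_monoid (tensor K M N)) f"
  by (simp add: fun_eq_iff tensor_lift_def finprod_def int_pow_def nat_pow_def m_inv_def Let_def tensor_def cong: if_cong)

lemma balanced_addI:
  assumes "\<And>x y. \<lbrakk>x \<in> carrier M; y \<in> carrier N\<rbrakk> \<Longrightarrow> f x y \<in> carrier C"
    and "\<And>x x' y. \<lbrakk>x \<in> carrier M; x' \<in> carrier M; y \<in> carrier N\<rbrakk> \<Longrightarrow>
      f (x \<oplus>\<^bsub>M\<^esub> x') y = f x y \<oplus>\<^bsub>C\<^esub> f x' y"
    and "\<And>x y y'. \<lbrakk>x \<in> carrier M; y \<in> carrier N; y' \<in> carrier N\<rbrakk> \<Longrightarrow>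
      f x (y \<oplus>\<^bsub>N\<^esub> y') = f x y \<oplus>\<^bsub>C\<^esub> f x y'"
    and "\<And>c x y. \<lbrakk>c \<in> carrier K; x \<in> carrier M; y \<in> carrier N\<rbrakk> \<Longrightarrow>
      f (c \<odot>\<^bsub>M\<^esub> x) y = f x (c \<odot>\<^bsub>N\<^esub> y)"
  shows "balanced K M N (add_monoid C) f"
  using assms by (simp add: balanced_def)

locale tensor_modules = M: module K M + N: module K N
  for K :: "('k, 'r) ring_scheme" and M :: "('k, 'a, 'r1) module_scheme"
    and N :: "('k, 'b, 'r2) module_scheme"
begin

abbreviation T where "T \<equiv> tensor K M N"
abbreviation pure where "pure \<equiv> pure_tensor K M N"
abbreviation Z where "Z \<equiv> free_Abelian_group (carrier M \<times> carrier N)"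

lemma comm_group_tensor_group: "comm_group (tensor_group K M N)"
  unfolding tensor_group_def
  by (rule comm_group.abelian_FactGroup[OF abelian_free_Abelian_group
      normal_imp_subgroup[OF tensor_null_normal[OF M.module_axioms N.module_axioms]]])

lemma abelian_group_tensor: "abelian_group T"
proof -
  interpret G: comm_group "tensor_group K M N" by (rule comm_group_tensor_group)
  show ?thesis
    by (rule abelian_groupI) (simp_all add: tensor_def G.m_ac G.l_inv_ex)
qed

sublocale T: abelian_group T by (rule abelian_group_tensor)

lemma tensor_group_simps:
  "carrier (tensor_group K M N) = carrier T"
  "monoid.mult (tensor_group K M N) = add T"
  "\<one>\<^bsub>tensor_group K M N\<^esub> = \<zero>\<^bsub>T\<^esub>"
  by (simp_all add: tensor_def)

lemma frag_add_closed: "\<lbrakk>s \<in> carrier Z; t \<in> carrier Z\<rbrakk> \<Longrightarrow> s + t \<in> carrier Z"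
  using keys_add[of s t] by auto

lemma coset_add:
  assumes "s \<in> carrier Z" "t \<in> carrier Z"
  shows "tensor_null K M N #>\<^bsub>Z\<^esub> (s + t)
    = (tensor_null K M N #>\<^bsub>Z\<^esub> s) \<oplus>\<^bsub>T\<^esub> (tensor_null K M N #>\<^bsub>Z\<^esub> t)"
  using normal.rcos_sum[OF tensor_null_normal[OF M.module_axioms N.module_axioms], of s t] assms
  by (simp add: tensor_def tensor_group_def)

lemma coset_eqI:
  assumes "s - t \<in> tensor_null K M N" "t \<in> carrier Z"
  shows "tensor_null K M N #>\<^bsub>Z\<^esub> s = tensor_null K M N #>\<^bsub>Z\<^esub> t"
proof -
  interpret Z: comm_group Z by (rule abelian_free_Abelian_group)
  \<comment> \<open>The operation of \<open>Z\<close> is addition of formal sums, so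
    \<open>s\<close> differs from \<open>t\<close> by an element of the null subgroup.\<close>
  have "s = (s - t) \<otimes>\<^bsub>Z\<^esub> t" by simp
  then have "s \<in> tensor_null K M N #>\<^bsub>Z\<^esub> t"
    using assms(1) unfolding r_coset_def by blast
  then show ?thesis
    by (rule Z.repr_independence[symmetric, OF _ assms(2)
      normal_imp_subgroup[OF tensor_null_normal[OF M.module_axioms N.module_axioms]]])
qed

lemma carrier_tensor: "carrier T = (\<lambda>t. tensor_null K M N #>\<^bsub>Z\<^esub> t) ` carrier Z"
  by (simp add: tensor_def tensor_group_def carrier_FactGroup)

lemma pure_closed [simp, intro]:
  "\<lbrakk>x \<in> carrier M; y \<in> carrier N\<rbrakk> \<Longrightarrow> pure x y \<in> carrier T"
  unfolding carrier_tensor pure_tensor_def by (intro imageI) simp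

lemma relator_null: "r \<in> tensor_relators K M N \<Longrightarrow> r \<in> tensor_null K M N"
  unfolding tensor_null_def by (rule generate.incl)

lemma pure_add_left:
  assumes "x \<in> carrier M" "x' \<in> carrier M" "y \<in> carrier N"
  shows "pure (x \<oplus>\<^bsub>M\<^esub> x') y = pure x y \<oplus>\<^bsub>T\<^esub> pure x' y"
proof -
  have "frag_of (x \<oplus>\<^bsub>M\<^esub> x', y) - (frag_of (x, y) + frag_of (x', y)) \<in> tensor_null K M N"
    using assms unfolding diff_diff_add[symmetric]
    by (intro relator_null) (auto simp: tensor_relators_def)
  moreover have "frag_of (x, y) + frag_of (x', y) \<in> carrier Z"
    using assms by (intro frag_add_closed) auto
  ultimately show ?thesis
    using assms by (simp add: pure_tensor_def coset_eqI flip: coset_add)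
qed

lemma pure_add_right:
  assumes "x \<in> carrier M" "y \<in> carrier N" "y' \<in> carrier N"
  shows "pure x (y \<oplus>\<^bsub>N\<^esub> y') = pure x y \<oplus>\<^bsub>T\<^esub> pure x y'"
proof -
  have "frag_of (x, y \<oplus>\<^bsub>N\<^esub> y') - (frag_of (x, y) + frag_of (x, y')) \<in> tensor_null K M N"
    using assms unfolding diff_diff_add[symmetric]
    by (intro relator_null) (auto simp: tensor_relators_def)
  moreover have "frag_of (x, y) + frag_of (x, y') \<in> carrier Z"
    using assms by (intro frag_add_closed) auto
  ultimately show ?thesis
    using assms by (simp add: pure_tensor_def coset_eqI flip: coset_add)
qed

lemma pure_smult:
  assumes "c \<in> carrier K" "x \<in> carrier M" "y \<in> carrier N"
  shows "pure (c \<odot>\<^bsub>M\<^esub> x) y = pure x (c \<odot>\<^bsub>N\<^esub> y)"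
  unfolding pure_tensor_def
  using assms by (intro coset_eqI relator_null) (auto simp: tensor_relators_def)

lemma pure_zero_left:
  assumes "y \<in> carrier N"
  shows "pure \<zero>\<^bsub>M\<^esub> y = \<zero>\<^bsub>T\<^esub>"
  using pure_add_left[of "\<zero>\<^bsub>M\<^esub>" "\<zero>\<^bsub>M\<^esub>" y] assms
    T.add.l_cancel_one[of "pure \<zero>\<^bsub>M\<^esub> y" "pure \<zero>\<^bsub>M\<^esub> y"] by simp

lemma pure_minus_left:
  assumes "x \<in> carrier M" "y \<in> carrier N"
  shows "pure (\<ominus>\<^bsub>M\<^esub> x) y = \<ominus>\<^bsub>T\<^esub> pure x y"
proof -
  show ?thesis
    using pure_add_left[of "\<ominus>\<^bsub>M\<^esub> x" x y] assms pure_zero_left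
    by (intro T.minus_equality[symmetric]) (auto simp: M.l_neg)
qed

text \<open>Every tensor is a sum of pure tensors: zero is the pure tensor of two zeros, and a minus
  sign can be absorbed into the left factor. Hence there is no case for zero or negation.\<close>

lemma tensor_induct [consumes 1, case_names pure add]:
  assumes X: "X \<in> carrier T"
    and pure: "\<And>x y. \<lbrakk>x \<in> carrier M; y \<in> carrier N\<rbrakk> \<Longrightarrow> P (pure x y)"
    and add: "\<And>X Y. \<lbrakk>X \<in> carrier T; Y \<in> carrier T; P X; P Y\<rbrakk> \<Longrightarrow> P (X \<oplus>\<^bsub>T\<^esub> Y)"
  shows "P X"
proof -
  let ?c = "\<lambda>t. tensor_null K M N #>\<^bsub>Z\<^esub> t"
  have cT: "?c t \<in> carrier T" if "t \<in> carrier Z" for t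
    using that unfolding carrier_tensor by (rule imageI)
  \<comment> \<open>The coset of 0 is idempotent under addition, so cancellation makes it
    zero.\<close>
  have c0: "?c 0 = \<zero>\<^bsub>T\<^esub>"
    using coset_add[of 0 0] cT[of 0] T.add.l_cancel_one[of "?c 0" "?c 0"] by simp
  have neg: "?c (- t) = \<ominus>\<^bsub>T\<^esub> ?c t" if "t \<in> carrier Z" for t
    using that coset_add[of "- t" t] cT[of t] cT[of "- t"] c0
    by (intro T.minus_equality[symmetric]) auto
  obtain t where t: "X = ?c t" "t \<in> carrier Z" using X unfolding carrier_tensor by blast
  then have "Poly_Mapping.keys t \<subseteq> carrier M \<times> carrier N" by simp
  \<comment> \<open>\<open>frag_induction\<close> builds formal sums by differences. Carrying
    \<open>P\<close> for the negative as well turns a difference into a sum, to which the rule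
    \<open>add\<close> applies.\<close>
  then have "t \<in> carrier Z \<and> P (?c t) \<and> P (\<ominus>\<^bsub>T\<^esub> ?c t)"
  proof (induction t rule: frag_induction)
    case zero
    have "\<ominus>\<^bsub>T\<^esub> ?c 0 = ?c 0" using neg[of 0] by simp
    moreover have "P (?c 0)"
      using pure[of "\<zero>\<^bsub>M\<^esub>" "\<zero>\<^bsub>N\<^esub>"] by (simp add: c0 pure_zero_left)
    ultimately show ?case by simp
  next
    case (one p)
    then obtain x y where xy: "p = (x, y)" "x \<in> carrier M" "y \<in> carrier N" by auto
    then have "P (pure x y)" "P (\<ominus>\<^bsub>T\<^esub> pure x y)"
      using pure[of x y] pure[of "\<ominus>\<^bsub>M\<^esub> x" y] by (simp_all add: pure_minus_left)
    then show ?case using xy by (simp add: pure_tensor_def)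
  next
    case (diff a b)
    then have ab: "a \<in> carrier Z" "- b \<in> carrier Z" "b \<in> carrier Z" by auto
    have "?c (a - b) = ?c a \<oplus>\<^bsub>T\<^esub> \<ominus>\<^bsub>T\<^esub> ?c b"
      using coset_add[OF ab(1,2)] neg[OF ab(3)] by simp
    moreover have "\<ominus>\<^bsub>T\<^esub> (?c a \<oplus>\<^bsub>T\<^esub> \<ominus>\<^bsub>T\<^esub> ?c b) = \<ominus>\<^bsub>T\<^esub> ?c a \<oplus>\<^bsub>T\<^esub> ?c b"
      using cT[OF ab(1)] cT[OF ab(3)] by (simp add: T.minus_add)
    moreover have "a - b \<in> carrier Z"
      using ab keys_diff[of a b] by auto
    ultimately show ?case using diff cT[OF ab(1)] cT[OF ab(3)] by (auto intro!: add)
  qed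
  then show ?thesis using t by simp
qed

section \<open>Homomorphisms induced by balanced maps\<close>

context
  fixes C f
  assumes C: "abelian_group C" and f: "balanced K M N (add_monoid C) f"
begin

lemmas comm_group_C = abelian_group.a_comm_group[OF C]

lemma lift_pure:
  "\<lbrakk>x \<in> carrier M; y \<in> carrier N\<rbrakk> \<Longrightarrow> tensor_lift (add_monoid C) f (pure x y) = f x y"
  by (rule tensor_lift_pure[OF M.module_axioms N.module_axioms comm_group_C f])

lemma lift_closed: "X \<in> carrier T \<Longrightarrow> tensor_lift (add_monoid C) f X \<in> carrier C"
  using hom_in_carrier[OF tensor_lift_hom[OF M.module_axioms N.module_axioms comm_group_C f]]
  by (simp add: tensor_def)

lemma lift_add: "\<lbrakk>X \<in> carrier T; Y \<in> carrier T\<rbrakk> \<Longrightarrow>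
  tensor_lift (add_monoid C) f (X \<oplus>\<^bsub>T\<^esub> Y)
    = tensor_lift (add_monoid C) f X \<oplus>\<^bsub>C\<^esub> tensor_lift (add_monoid C) f Y"
  using hom_mult[OF tensor_lift_hom[OF M.module_axioms N.module_axioms comm_group_C f]]
  by (simp add: tensor_def)

end


text \<open>The generated subgroup adds only unit and inverses to sums of pure tensors. Both are
  pure tensors again, since \<open>S\<close> and \<open>S'\<close> contain zero and \<open>S\<close>
  is closed under negation. Membership in \<open>carrier T\<close> is carried along because
  \<open>add\<close> requires it.\<close>

lemma tensor_subspace_induct [consumes 1, case_names pure add]:
  assumes X: "X \<in> tensor_subspace K M N S S'"
    and S: "subgroup S (add_monoid M)" and S': "subgroup S' (add_monoid N)"
    and pure: "\<And>x y. \<lbrakk>x \<in> S; y \<in> S'\<rbrakk> \<Longrightarrow> P (pure x y)"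
    and add: "\<And>X Y. \<lbrakk>X \<in> carrier T; Y \<in> carrier T; P X; P Y\<rbrakk> \<Longrightarrow> P (X \<oplus>\<^bsub>T\<^esub> Y)"
  shows "X \<in> carrier T \<and> P X"
proof -
  interpret G: comm_group "tensor_group K M N" by (rule comm_group_tensor_group)
  have sub: "x \<in> carrier M" "y \<in> carrier N" if "x \<in> S" "y \<in> S'" for x y
    using subgroup.mem_carrier[OF S] subgroup.mem_carrier[OF S'] that by auto
  from X show ?thesis
    unfolding tensor_subspace_def
  proof (induction rule: generate.induct)
    case one
    have "\<zero>\<^bsub>M\<^esub> \<in> S" "\<zero>\<^bsub>N\<^esub> \<in> S'"
      using subgroup.one_closed[OF S] subgroup.one_closed[OF S'] by simp_all
    then have "P (pure \<zero>\<^bsub>M\<^esub> \<zero>\<^bsub>N\<^esub>)" by (rule pure)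
    then show ?case by (simp add: pure_zero_left tensor_group_simps)
  next
    case (incl X)
    then show ?case using pure sub by auto
  next
    case (inv X)
    then obtain x y where xy: "X = pure x y" "x \<in> S" "y \<in> S'" by blast
    \<comment> \<open>The inverse is taken in the group that defines the subspace; it is identified
      with the negative in \<open>T\<close>, where the sign moves into the left factor.\<close>
    have "inv\<^bsub>tensor_group K M N\<^esub> X = \<ominus>\<^bsub>T\<^esub> pure x y"
    proof (rule G.inv_equality)
      show "(\<ominus>\<^bsub>T\<^esub> pure x y) \<otimes>\<^bsub>tensor_group K M N\<^esub> X = \<one>\<^bsub>tensor_group K M N\<^esub>"
        using sub xy by (simp add: tensor_group_simps T.l_neg)
    qed (use sub xy in \<open>auto simp: tensor_group_simps\<close>)
    also have "\<dots> = pure (\<ominus>\<^bsub>M\<^esub> x) y" using sub xy by (simp add: pure_minus_left)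
    finally have "inv\<^bsub>tensor_group K M N\<^esub> X = pure (\<ominus>\<^bsub>M\<^esub> x) y" .
    moreover have "\<ominus>\<^bsub>M\<^esub> x \<in> S"
      using subgroup.m_inv_closed[OF S xy(2)] by (simp add: a_inv_def)
    ultimately show ?case using pure sub xy by auto
  next
    case (eng X Y)
    then show ?case using add[of X Y] by (simp add: tensor_group_simps)
  qed
qed

end

subsection \<open>Tensor products of algebras\<close>

locale tensor_algebras = A: assoc_algebra K A + B: assoc_algebra K B
  for K :: "('k, 'r) ring_scheme" and A :: "('k, 'a, 'r1) module_scheme"
    and B :: "('k, 'b, 'r2) module_scheme"
begin

sublocale tensor_modules K A B by unfold_locales

text \<open>Well-definedness of the inner lift in the product: a scalar on \<open>a'\<close> leaves
  the left factor, crosses the tensor sign and enters the right factor at \<open>b'\<close>.\<close>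

lemma balanced_mult_pure:
  assumes "a \<in> carrier A" "b \<in> carrier B"
  shows "balanced K A B (add_monoid T) (\<lambda>a' b'. pure (a \<otimes>\<^bsub>A\<^esub> a') (b \<otimes>\<^bsub>B\<^esub> b'))"
  using assms
  by (intro balanced_addI)
    (auto simp: A.A.r_distr B.A.r_distr pure_add_left pure_add_right
      A.smult_mult_right B.smult_mult_right pure_smult)

section \<open>The product on the tensor product of two algebras\<close>

context
begin

text \<open>Left multiplication by the pure tensor of \<open>a\<close> and \<open>b\<close>: the
  inner lift of the product in \<open>tensor\<close>.\<close>

private definition pmult where
  "pmult a b = tensor_lift (add_monoid T) (\<lambda>a' b'. pure (a \<otimes>\<^bsub>A\<^esub> a') (b \<otimes>\<^bsub>B\<^esub> b'))"

private lemmas pmult_pure = lift_pure[OF T.abelian_group_axioms balanced_mult_pure, folded pmult_def]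
private lemmas pmult_closed = lift_closed[OF T.abelian_group_axioms balanced_mult_pure, folded pmult_def]
private lemmas pmult_add = lift_add[OF T.abelian_group_axioms balanced_mult_pure, folded pmult_def]

text \<open>Well-definedness of the outer lift. Each law is an equation between additive functions
  of \<open>Y\<close>, so it is checked on pure \<open>Y\<close>.\<close>

private lemma balanced_pmult:
  assumes Y: "Y \<in> carrier T"
  shows "balanced K A B (add_monoid T) (\<lambda>a b. pmult a b Y)"
proof (rule balanced_addI)
  show "pmult (a \<oplus>\<^bsub>A\<^esub> a') b Y = pmult a b Y \<oplus>\<^bsub>T\<^esub> pmult a' b Y"
    if "a \<in> carrier A" "a' \<in> carrier A" "b \<in> carrier B" for a a' b
    using Y that
    by (induction rule: tensor_induct)
      (simp_all add: pmult_pure pmult_add pmult_closed A.A.l_distr pure_add_left T.a_ac)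
  show "pmult a (b \<oplus>\<^bsub>B\<^esub> b') Y = pmult a b Y \<oplus>\<^bsub>T\<^esub> pmult a b' Y"
    if "a \<in> carrier A" "b \<in> carrier B" "b' \<in> carrier B" for a b b'
    using Y that
    by (induction rule: tensor_induct)
      (simp_all add: pmult_pure pmult_add pmult_closed B.A.l_distr pure_add_right T.a_ac)
  show "pmult (c \<odot>\<^bsub>A\<^esub> a) b Y = pmult a (c \<odot>\<^bsub>B\<^esub> b) Y"
    if "c \<in> carrier K" "a \<in> carrier A" "b \<in> carrier B" for a b c
    using Y that
    by (induction rule: tensor_induct)
      (simp_all add: pmult_pure pmult_add A.smult_mult_left B.smult_mult_left pure_smult)
qed (use Y pmult_closed in auto)

private lemma mult_eq: "X \<otimes>\<^bsub>T\<^esub> Y = tensor_lift (add_monoid T) (\<lambda>a b. pmult a b Y) X"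
  by (simp add: pmult_def flip: tensor_lift_tensor_group) (simp add: tensor_def)

lemma tensor_mult_closed: "\<lbrakk>X \<in> carrier T; Y \<in> carrier T\<rbrakk> \<Longrightarrow> X \<otimes>\<^bsub>T\<^esub> Y \<in> carrier T"
  unfolding mult_eq by (rule lift_closed[OF T.abelian_group_axioms balanced_pmult])

lemma tensor_mult_add_left:
  "\<lbrakk>X \<in> carrier T; X' \<in> carrier T; Y \<in> carrier T\<rbrakk>
    \<Longrightarrow> (X \<oplus>\<^bsub>T\<^esub> X') \<otimes>\<^bsub>T\<^esub> Y = X \<otimes>\<^bsub>T\<^esub> Y \<oplus>\<^bsub>T\<^esub> X' \<otimes>\<^bsub>T\<^esub> Y"
  unfolding mult_eq by (rule lift_add[OF T.abelian_group_axioms balanced_pmult])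

private lemma mult_pure_eq_pmult:
  "\<lbrakk>a \<in> carrier A; b \<in> carrier B; Y \<in> carrier T\<rbrakk> \<Longrightarrow> pure a b \<otimes>\<^bsub>T\<^esub> Y = pmult a b Y"
  unfolding mult_eq by (rule lift_pure[OF T.abelian_group_axioms balanced_pmult])

lemma tensor_mult_pure:
  "\<lbrakk>a \<in> carrier A; b \<in> carrier B; a' \<in> carrier A; b' \<in> carrier B\<rbrakk>
    \<Longrightarrow> pure a b \<otimes>\<^bsub>T\<^esub> pure a' b' = pure (a \<otimes>\<^bsub>A\<^esub> a') (b \<otimes>\<^bsub>B\<^esub> b')"
  by (simp add: mult_pure_eq_pmult pmult_pure)

text \<open>Left additivity is built into the outer lift, right additivity into the inner one.
  Induction on \<open>X\<close> reduces to a pure left factor, where the product is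
  \<open>pmult\<close>.\<close>

lemma tensor_mult_add_right:
  assumes "X \<in> carrier T" "Y \<in> carrier T" "Y' \<in> carrier T"
  shows "X \<otimes>\<^bsub>T\<^esub> (Y \<oplus>\<^bsub>T\<^esub> Y') = X \<otimes>\<^bsub>T\<^esub> Y \<oplus>\<^bsub>T\<^esub> X \<otimes>\<^bsub>T\<^esub> Y'"
  using assms
  by (induction rule: tensor_induct)
    (simp_all add: mult_pure_eq_pmult pmult_add tensor_mult_add_left tensor_mult_closed T.a_ac)

end

lemma tensor_one: "\<one>\<^bsub>T\<^esub> = pure \<one>\<^bsub>A\<^esub> \<one>\<^bsub>B\<^esub>"
  by (simp add: tensor_def)

text \<open>Both sides are additive in each of the three arguments, so three nested inductions leave
  associativity in the two factors.\<close>

lemma tensor_mult_assoc: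
  assumes X: "X \<in> carrier T" and Y: "Y \<in> carrier T" and W: "W \<in> carrier T"
  shows "X \<otimes>\<^bsub>T\<^esub> Y \<otimes>\<^bsub>T\<^esub> W = X \<otimes>\<^bsub>T\<^esub> (Y \<otimes>\<^bsub>T\<^esub> W)"
  using X
proof (induction rule: tensor_induct)
  case (pure a b)
  note ab = pure
  from Y show ?case
  proof (induction rule: tensor_induct)
    case (pure a' b')
    from W show ?case
      using pure ab
      by (induction rule: tensor_induct)
        (simp_all add: tensor_mult_pure tensor_mult_add_right tensor_mult_closed A.A.m_assoc B.A.m_assoc)
  qed (use W ab in \<open>simp_all add: tensor_mult_add_right tensor_mult_add_left tensor_mult_closed\<close>)
qed (use Y W in \<open>simp_all add: tensor_mult_add_left tensor_mult_closed\<close>)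

lemma ring_tensor: "ring T"
proof (rule ringI)
  show "monoid T"
  proof (rule monoidI)
    show "\<one>\<^bsub>T\<^esub> \<in> carrier T" by (simp add: tensor_one)
    show "\<one>\<^bsub>T\<^esub> \<otimes>\<^bsub>T\<^esub> X = X" if "X \<in> carrier T" for X
      using that by (induction rule: tensor_induct)
        (simp_all add: tensor_one tensor_mult_pure tensor_mult_add_right)
    show "X \<otimes>\<^bsub>T\<^esub> \<one>\<^bsub>T\<^esub> = X" if "X \<in> carrier T" for X
      using that by (induction rule: tensor_induct)
        (simp_all add: tensor_one tensor_mult_pure tensor_mult_add_left)
  qed (simp_all add: tensor_mult_closed tensor_mult_assoc)
qed (simp_all add: tensor_mult_add_left tensor_mult_add_right T.abelian_group_axioms)

text \<open>The balance condition asks for two scalars acting on the left factor to be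
  interchangeable, which is commutativity of \<open>K\<close>.\<close>

lemma balanced_smult_pure:
  "c \<in> carrier K \<Longrightarrow> balanced K A B (add_monoid T) (\<lambda>a b. pure (c \<odot>\<^bsub>A\<^esub> a) b)"
  by (intro balanced_addI)
    (auto simp: A.smult_r_distr pure_add_left pure_add_right A.K.m_comm
      simp flip: A.smult_assoc1 pure_smult)

lemma smult_eq: "c \<odot>\<^bsub>T\<^esub> X = tensor_lift (add_monoid T) (\<lambda>a b. pure (c \<odot>\<^bsub>A\<^esub> a) b) X"
  by (simp flip: tensor_lift_tensor_group) (simp add: tensor_def)

lemmas tensor_smult_pure = lift_pure[OF T.abelian_group_axioms balanced_smult_pure, folded smult_eq]
lemmas tensor_smult_closed = lift_closed[OF T.abelian_group_axioms balanced_smult_pure, folded smult_eq]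
lemmas tensor_smult_add = lift_add[OF T.abelian_group_axioms balanced_smult_pure, folded smult_eq]

lemma module_tensor: "module K T"
proof (rule moduleI)
  show "(c \<oplus>\<^bsub>K\<^esub> d) \<odot>\<^bsub>T\<^esub> X = c \<odot>\<^bsub>T\<^esub> X \<oplus>\<^bsub>T\<^esub> d \<odot>\<^bsub>T\<^esub> X"
    if "c \<in> carrier K" "d \<in> carrier K" "X \<in> carrier T" for c d X
    using that(3,1,2) by (induction rule: tensor_induct)
      (simp_all add: tensor_smult_pure tensor_smult_add A.smult_l_distr pure_add_left
        T.a_ac tensor_smult_closed)
  show "(c \<otimes>\<^bsub>K\<^esub> d) \<odot>\<^bsub>T\<^esub> X = c \<odot>\<^bsub>T\<^esub> (d \<odot>\<^bsub>T\<^esub> X)"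
    if "c \<in> carrier K" "d \<in> carrier K" "X \<in> carrier T" for c d X
    using that(3,1,2) by (induction rule: tensor_induct)
      (simp_all add: tensor_smult_pure tensor_smult_add A.smult_assoc1 tensor_smult_closed)
  show "\<one>\<^bsub>K\<^esub> \<odot>\<^bsub>T\<^esub> X = X" if "X \<in> carrier T" for X
    using that by (induction rule: tensor_induct)
      (simp_all add: tensor_smult_pure tensor_smult_add)
qed (simp_all add: module.axioms(1)[OF A.module_axioms] T.abelian_group_axioms tensor_smult_closed tensor_smult_add)

text \<open>This allows a tensor product to serve as a factor of another one, as in the threefold
  product.\<close>

lemma assoc_algebra_tensor: "assoc_algebra K T"
proof (intro assoc_algebra.intro assoc_algebra_axioms.intro)
  show "field K" by (rule A.K.field_axioms)
  show "module K T" by (rule module_tensor)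
  show "ring T" by (rule ring_tensor)
  show "(c \<odot>\<^bsub>T\<^esub> X) \<otimes>\<^bsub>T\<^esub> Y = c \<odot>\<^bsub>T\<^esub> (X \<otimes>\<^bsub>T\<^esub> Y)"
    if "c \<in> carrier K" "X \<in> carrier T" "Y \<in> carrier T" for c X Y
    using that(2)
  proof (induction rule: tensor_induct)
    case (pure a b)
    from that(3) show ?case
      using pure that(1) by (induction rule: tensor_induct)
        (simp_all add: tensor_mult_pure tensor_smult_pure tensor_smult_add tensor_mult_add_right
          tensor_mult_closed A.smult_mult_left)
  qed (use that in \<open>simp_all add: tensor_smult_add tensor_mult_add_left tensor_mult_closed tensor_smult_closed\<close>)
  show "X \<otimes>\<^bsub>T\<^esub> (c \<odot>\<^bsub>T\<^esub> Y) = c \<odot>\<^bsub>T\<^esub> (X \<otimes>\<^bsub>T\<^esub> Y)"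
    if "c \<in> carrier K" "X \<in> carrier T" "Y \<in> carrier T" for c X Y
    using that(2)
  proof (induction rule: tensor_induct)
    case (pure a b)
    from that(3) show ?case
      using pure that(1) by (induction rule: tensor_induct)
        (simp_all add: tensor_mult_pure tensor_smult_pure tensor_smult_add tensor_mult_add_right
          tensor_mult_closed tensor_smult_closed A.smult_mult_right)
  qed (use that in \<open>simp_all add: tensor_smult_add tensor_mult_add_left tensor_mult_closed tensor_smult_closed\<close>)
qed

text \<open>Multiplicativity on pure tensors extends by additivity in each argument. The rule yields
  that \<Delta> \<otimes> id, id \<otimes> \<Delta>, \<epsilon> \<otimes> id and id \<otimes>
  \<epsilon> are ring homomorphisms.\<close>

lemma lift_ring_hom:
  assumes C: "ring C" and f: "balanced K A B (add_monoid C) f"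
    and mult: "\<And>a b a' b'. \<lbrakk>a \<in> carrier A; b \<in> carrier B; a' \<in> carrier A; b' \<in> carrier B\<rbrakk>
      \<Longrightarrow> f (a \<otimes>\<^bsub>A\<^esub> a') (b \<otimes>\<^bsub>B\<^esub> b') = f a b \<otimes>\<^bsub>C\<^esub> f a' b'"
    and one: "f \<one>\<^bsub>A\<^esub> \<one>\<^bsub>B\<^esub> = \<one>\<^bsub>C\<^esub>"
  shows "tensor_lift (add_monoid C) f \<in> ring_hom T C"
proof -
  interpret C: ring C by (rule C)
  note [simp] = lift_pure[OF C.abelian_group_axioms f] lift_closed[OF C.abelian_group_axioms f]
    lift_add[OF C.abelian_group_axioms f]
  have f_closed: "f a b \<in> carrier C" if "a \<in> carrier A" "b \<in> carrier B" for a b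
    using f that by (simp add: balanced_def)
  show ?thesis
  proof (rule ring_hom_memI)
    fix X Y assume X: "X \<in> carrier T" and Y: "Y \<in> carrier T"
    from X show "tensor_lift (add_monoid C) f (X \<otimes>\<^bsub>T\<^esub> Y)
      = tensor_lift (add_monoid C) f X \<otimes>\<^bsub>C\<^esub> tensor_lift (add_monoid C) f Y"
    proof (induction rule: tensor_induct)
      case (pure a b)
      from Y pure show ?case
        by (induction rule: tensor_induct)
          (simp_all add: tensor_mult_pure mult tensor_mult_add_right C.r_distr tensor_mult_closed f_closed)
    qed (use Y in \<open>simp_all add: tensor_mult_add_left tensor_mult_closed C.l_distr\<close>)
  qed (simp_all add: tensor_one one)
qed

end


subsection \<open>Products of twisting elements\<close>

context hopf_algebra
begin

section \<open>The rings H \<otimes> H and H \<otimes> (H \<otimes> H)\<close>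

sublocale T2: tensor_algebras K H H by unfold_locales
sublocale R2: ring "tensor2 K H" by (rule T2.ring_tensor)
sublocale T3: tensor_algebras K H "tensor2 K H"
  by (intro tensor_algebras.intro assoc_algebra_axioms T2.assoc_algebra_tensor)
sublocale R3: ring "tensor3 K H" by (rule T3.ring_tensor)

lemma comult_closed: "a \<in> carrier H \<Longrightarrow> comult H a \<in> carrier (tensor2 K H)"
  by (rule ring_hom_closed[OF comult_ring_hom])

lemma comult_smult:
  "\<lbrakk>c \<in> carrier K; a \<in> carrier H\<rbrakk> \<Longrightarrow> comult H (c \<odot>\<^bsub>H\<^esub> a) = c \<odot>\<^bsub>tensor2 K H\<^esub> comult H a"
  using comult_linear by (simp add: linear_maps_def)

text \<open>This is \<open>X \<otimes> b\<close> moved from \<open>(H \<otimes> H) \<otimes> H\<close> to \<open>H \<otimes> (H \<otimes> H)\<close>.\<close>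

definition append3 where
  "append3 X b = tensor_lift (add_monoid (tensor3 K H)) (\<lambda>a1 a2. pure3 K H a1 a2 b) X"

text \<open>A scalar leaving the first slot acts on the tensor of the last two, where it can be
  placed on \<open>a2\<close>.\<close>

lemma balanced_pure3:
  "b \<in> carrier H \<Longrightarrow> balanced K H H (add_monoid (tensor3 K H)) (\<lambda>a1 a2. pure3 K H a1 a2 b)"
  by (intro balanced_addI)
    (simp_all add: T3.pure_add_left T3.pure_add_right T2.pure_add_left T3.pure_smult
      T2.tensor_smult_pure)

lemmas append3_pure = T2.lift_pure[OF T3.abelian_group_tensor balanced_pure3, folded append3_def]
lemmas append3_closed = T2.lift_closed[OF T3.abelian_group_tensor balanced_pure3, folded append3_def]
lemmas append3_add_left = T2.lift_add[OF T3.abelian_group_tensor balanced_pure3, folded append3_def]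

lemma append3_add_right:
  assumes "X \<in> carrier (tensor2 K H)" "b \<in> carrier H" "b' \<in> carrier H"
  shows "append3 X (b \<oplus>\<^bsub>H\<^esub> b') = append3 X b \<oplus>\<^bsub>tensor3 K H\<^esub> append3 X b'"
  using assms
  by (induction rule: T2.tensor_induct)
    (simp_all add: append3_pure append3_add_left append3_closed T2.pure_add_right T3.pure_add_right
      T3.T.a_ac)

text \<open>With linearity of \<Delta>, this is the balance condition for \<open>a\<close>,
  \<open>b\<close> \<mapsto> \<Delta>(a) \<otimes> b.\<close>

lemma append3_smult:
  assumes "X \<in> carrier (tensor2 K H)" "b \<in> carrier H" "c \<in> carrier K"
  shows "append3 (c \<odot>\<^bsub>tensor2 K H\<^esub> X) b = append3 X (c \<odot>\<^bsub>H\<^esub> b)"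
  using assms
  by (induction rule: T2.tensor_induct)
    (simp_all add: append3_pure append3_add_left T2.tensor_smult_pure T2.tensor_smult_add
      T2.tensor_smult_closed T3.pure_smult T2.pure_smult)

text \<open>Products are computed slotwise. This makes both t \<mapsto> t \<otimes> 1 and \<Delta>
  \<otimes> id multiplicative, and lets \<open>G\<close> \<otimes> 1 be compared with \<Delta>(s)
  \<otimes> s' inside H \<otimes> H.\<close>

lemma append3_mult:
  assumes X: "X \<in> carrier (tensor2 K H)" and Y: "Y \<in> carrier (tensor2 K H)"
    and b: "b \<in> carrier H" "b' \<in> carrier H"
  shows "append3 X b \<otimes>\<^bsub>tensor3 K H\<^esub> append3 Y b' = append3 (X \<otimes>\<^bsub>tensor2 K H\<^esub> Y) (b \<otimes>\<^bsub>H\<^esub> b')"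
  using X
proof (induction rule: T2.tensor_induct)
  case (pure x y)
  from Y show ?case
    using pure b
    by (induction rule: T2.tensor_induct)
      (simp_all add: append3_pure append3_add_left append3_closed T2.tensor_mult_pure
        T3.tensor_mult_pure R2.r_distr R3.r_distr)
qed (use Y b in \<open>simp_all add: append3_add_left append3_closed R2.l_distr R3.l_distr\<close>)

section \<open>The legs 12 and 23, and the homomorphisms \<Delta> \<otimes> id and id \<otimes>
  \<Delta>\<close>

lemma tensor2_12_eq: "tensor2_12 K H X = append3 X \<one>\<^bsub>H\<^esub>"
  by (simp add: tensor2_12_def append3_def)

lemma balanced_23:
  "balanced K H H (add_monoid (tensor3 K H)) (\<lambda>a b. pure3 K H \<one>\<^bsub>H\<^esub> a b)"
  by (intro balanced_addI)
    (simp_all add: T3.pure_add_right T2.pure_add_left T2.pure_add_right T2.pure_smult)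

text \<open>Since the threefold product is nested to the right, 1 \<otimes> X is a single pure
  tensor; only leg 12 needs the reassociation in \<open>append3\<close>.\<close>

lemma tensor2_23_eq:
  assumes "X \<in> carrier (tensor2 K H)"
  shows "tensor2_23 K H X = pure_tensor K H (tensor2 K H) \<one>\<^bsub>H\<^esub> X"
  using assms
  by (induction rule: T2.tensor_induct)
    (simp_all add: tensor2_23_def T2.lift_pure[OF T3.abelian_group_tensor balanced_23]
      T2.lift_add[OF T3.abelian_group_tensor balanced_23] T3.pure_add_right)

lemma tensor2_12_mult:
  "\<lbrakk>X \<in> carrier (tensor2 K H); Y \<in> carrier (tensor2 K H)\<rbrakk> \<Longrightarrow>
    tensor2_12 K H (X \<otimes>\<^bsub>tensor2 K H\<^esub> Y) = tensor2_12 K H X \<otimes>\<^bsub>tensor3 K H\<^esub> tensor2_12 K H Y"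
  by (simp add: tensor2_12_eq append3_mult)

lemma tensor2_23_mult:
  "\<lbrakk>X \<in> carrier (tensor2 K H); Y \<in> carrier (tensor2 K H)\<rbrakk> \<Longrightarrow>
    tensor2_23 K H (X \<otimes>\<^bsub>tensor2 K H\<^esub> Y) = tensor2_23 K H X \<otimes>\<^bsub>tensor3 K H\<^esub> tensor2_23 K H Y"
  by (simp add: tensor2_23_eq T3.tensor_mult_pure)

lemma balanced_comult_id:
  "balanced K H H (add_monoid (tensor3 K H)) (\<lambda>a b. append3 (comult H a) b)"
  by (intro balanced_addI)
    (simp_all add: append3_closed comult_closed append3_add_left append3_add_right append3_smult
      comult_smult ring_hom_add[OF comult_ring_hom])

lemma comult_id_eq:
  "comult_id K H = tensor_lift (add_monoid (tensor3 K H)) (\<lambda>a b. append3 (comult H a) b)"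
  by (simp add: comult_id_def append3_def)

lemmas comult_id_pure = T2.lift_pure[OF T3.abelian_group_tensor balanced_comult_id, folded comult_id_eq]

text \<open>On pure tensors this is multiplicativity of \<Delta> in the first two slots and of the
  product of \<open>H\<close> in the third.\<close>

lemma comult_id_ring_hom: "comult_id K H \<in> ring_hom (tensor2 K H) (tensor3 K H)"
  unfolding comult_id_eq
  by (rule T2.lift_ring_hom[OF T3.ring_tensor balanced_comult_id])
    (simp_all add: append3_mult comult_closed ring_hom_mult[OF comult_ring_hom]
      ring_hom_one[OF comult_ring_hom] T2.tensor_one T3.tensor_one append3_pure)

lemma balanced_id_comult:
  "balanced K H H (add_monoid (tensor3 K H)) (\<lambda>a b. pure_tensor K H (tensor2 K H) a (comult H b))"
  by (intro balanced_addI)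
    (simp_all add: comult_closed T3.pure_add_left T3.pure_add_right T3.pure_smult
      comult_smult ring_hom_add[OF comult_ring_hom])

lemmas id_comult_pure =
  T2.lift_pure[OF T3.abelian_group_tensor balanced_id_comult, folded id_comult_def]

lemma id_comult_ring_hom: "id_comult K H \<in> ring_hom (tensor2 K H) (tensor3 K H)"
  unfolding id_comult_def
  by (rule T2.lift_ring_hom[OF T3.ring_tensor balanced_id_comult])
    (simp_all add: T3.tensor_mult_pure comult_closed ring_hom_mult[OF comult_ring_hom]
      ring_hom_one[OF comult_ring_hom] T3.tensor_one)

section \<open>The homomorphisms \<epsilon> \<otimes> id and id \<otimes> \<epsilon>\<close>

lemma counit_closed: "a \<in> carrier H \<Longrightarrow> counit H a \<in> carrier K"
  by (rule ring_hom_closed[OF counit_ring_hom])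

text \<open>For counit values \<open>c\<close> and \<open>d\<close> this gives multiplicativity of
  \<epsilon> \<otimes> id and id \<otimes> \<epsilon> on pure tensors.\<close>

lemma smult_mult_smult:
  assumes "c \<in> carrier K" "d \<in> carrier K" "x \<in> carrier H" "y \<in> carrier H"
  shows "(c \<odot>\<^bsub>H\<^esub> x) \<otimes>\<^bsub>H\<^esub> (d \<odot>\<^bsub>H\<^esub> y) = (c \<otimes>\<^bsub>K\<^esub> d) \<odot>\<^bsub>H\<^esub> (x \<otimes>\<^bsub>H\<^esub> y)"
  using assms by (simp add: smult_mult_left smult_mult_right K.m_comm flip: smult_assoc1)

lemma counit_id_ring_hom: "counit_id H \<in> ring_hom (tensor2 K H) H"
  unfolding counit_id_def
proof (rule T2.lift_ring_hom[OF A.ring_axioms])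
  show "balanced K H H (add_monoid H) (\<lambda>a b. counit H a \<odot>\<^bsub>H\<^esub> b)"
    by (intro balanced_addI)
      (simp_all add: counit_closed counit_smult ring_hom_add[OF counit_ring_hom]
        smult_l_distr smult_r_distr K.m_comm flip: smult_assoc1)
qed (simp_all add: counit_closed smult_mult_smult ring_hom_mult[OF counit_ring_hom]
    ring_hom_one[OF counit_ring_hom])

lemma id_counit_ring_hom: "id_counit H \<in> ring_hom (tensor2 K H) H"
  unfolding id_counit_def
proof (rule T2.lift_ring_hom[OF A.ring_axioms])
  show "balanced K H H (add_monoid H) (\<lambda>a b. counit H b \<odot>\<^bsub>H\<^esub> a)"
    by (intro balanced_addI)
      (simp_all add: counit_closed counit_smult ring_hom_add[OF counit_ring_hom]
        smult_l_distr smult_r_distr K.m_comm flip: smult_assoc1)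
qed (simp_all add: counit_closed smult_mult_smult ring_hom_mult[OF counit_ring_hom]
    ring_hom_one[OF counit_ring_hom])

text \<open>The inductive step in general form: \<open>G\<close> will be the partial product and
  \<open>S\<close> the carrier of the next twist \<open>F\<close>. Commutation with \<Delta>(S)
  moves the legs of \<open>G\<close> past the images of \<open>F\<close>, separating the two cocycle
  equations.\<close>

lemma twisting_element_mult:
  assumes F: "twisting_element K H F" and G: "twisting_element K H G"
    and F_sub: "F \<in> tensor_subspace K H H S S" and S: "subgroup S (add_monoid H)"
    and commute: "\<And>a. a \<in> S \<Longrightarrow> G \<otimes>\<^bsub>tensor2 K H\<^esub> comult H a = comult H a \<otimes>\<^bsub>tensor2 K H\<^esub> G"
  shows "twisting_element K H (F \<otimes>\<^bsub>tensor2 K H\<^esub> G)"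
proof -
  have Fc: "F \<in> carrier (tensor2 K H)" and Gc: "G \<in> carrier (tensor2 K H)"
    using F G R2.Units_closed by (auto simp: twisting_element_def)
  have G12c: "tensor2_12 K H G \<in> carrier (tensor3 K H)"
    and G23c: "tensor2_23 K H G \<in> carrier (tensor3 K H)"
    and F12c: "tensor2_12 K H F \<in> carrier (tensor3 K H)"
    and F23c: "tensor2_23 K H F \<in> carrier (tensor3 K H)"
    using Fc Gc by (simp_all add: tensor2_12_eq tensor2_23_eq append3_closed)
  note L = ring_hom_closed[OF comult_id_ring_hom] and R = ring_hom_closed[OF id_comult_ring_hom]
  have SH: "a \<in> carrier H" if "a \<in> S" for a
    using subgroup.mem_carrier[OF S that] by simp
  \<comment> \<open>Both sides are additive in \<open>F\<close>, so F = s \<otimes> s' suffices. Its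
    image is \<Delta>(s) \<otimes> s', and G \<otimes> 1 meets only \<Delta>(s), with which
    \<open>G\<close> commutes.\<close>
  have left: "tensor2_12 K H G \<otimes>\<^bsub>tensor3 K H\<^esub> comult_id K H F
      = comult_id K H F \<otimes>\<^bsub>tensor3 K H\<^esub> tensor2_12 K H G"
    using T2.tensor_subspace_induct[OF F_sub S S, where P = "\<lambda>X.
        tensor2_12 K H G \<otimes>\<^bsub>tensor3 K H\<^esub> comult_id K H X
          = comult_id K H X \<otimes>\<^bsub>tensor3 K H\<^esub> tensor2_12 K H G"] G12c
    by (simp add: SH comult_id_pure tensor2_12_eq append3_mult commute Gc comult_closed
        ring_hom_add[OF comult_id_ring_hom] R3.l_distr R3.r_distr L)
  \<comment> \<open>Here the image of s \<otimes> s' is s \<otimes> \<Delta>(s'), and 1 \<otimes> G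
    meets only \<Delta>(s').\<close>
  have right: "tensor2_23 K H G \<otimes>\<^bsub>tensor3 K H\<^esub> id_comult K H F
      = id_comult K H F \<otimes>\<^bsub>tensor3 K H\<^esub> tensor2_23 K H G"
    using T2.tensor_subspace_induct[OF F_sub S S, where P = "\<lambda>X.
        tensor2_23 K H G \<otimes>\<^bsub>tensor3 K H\<^esub> id_comult K H X
          = id_comult K H X \<otimes>\<^bsub>tensor3 K H\<^esub> tensor2_23 K H G"] G23c
    by (simp add: SH id_comult_pure tensor2_23_eq T3.tensor_mult_pure commute Gc comult_closed
        ring_hom_add[OF id_comult_ring_hom] R3.l_distr R3.r_distr R)
  \<comment> \<open>Used with \<open>a\<close>, \<open>b\<close> the same leg of \<open>F\<close>
    and of \<open>G\<close>, and \<open>c\<close>, \<open>d\<close> the images of \<open>F\<close>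
    and \<open>G\<close> under the matching coproduct map.\<close>
  have swap: "(a \<otimes>\<^bsub>tensor3 K H\<^esub> b) \<otimes>\<^bsub>tensor3 K H\<^esub> (c \<otimes>\<^bsub>tensor3 K H\<^esub> d)
      = (a \<otimes>\<^bsub>tensor3 K H\<^esub> c) \<otimes>\<^bsub>tensor3 K H\<^esub> (b \<otimes>\<^bsub>tensor3 K H\<^esub> d)"
    if "b \<otimes>\<^bsub>tensor3 K H\<^esub> c = c \<otimes>\<^bsub>tensor3 K H\<^esub> b" "a \<in> carrier (tensor3 K H)"
      "b \<in> carrier (tensor3 K H)" "c \<in> carrier (tensor3 K H)" "d \<in> carrier (tensor3 K H)" for a b c d
    using that by (metis R3.m_assoc R3.m_closed)
  have eqF: "tensor2_12 K H F \<otimes>\<^bsub>tensor3 K H\<^esub> comult_id K H F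
      = tensor2_23 K H F \<otimes>\<^bsub>tensor3 K H\<^esub> id_comult K H F"
    and eqG: "tensor2_12 K H G \<otimes>\<^bsub>tensor3 K H\<^esub> comult_id K H G
      = tensor2_23 K H G \<otimes>\<^bsub>tensor3 K H\<^esub> id_comult K H G"
    using F G by (simp_all add: twisting_element_def twist_equations_def)
  \<comment> \<open>Expanding by multiplicativity and interchanging the middle factors gives, on
    each side, the corresponding side of \<open>eqF\<close> times that of
    \<open>eqG\<close>.\<close>
  have "tensor2_12 K H (F \<otimes>\<^bsub>tensor2 K H\<^esub> G) \<otimes>\<^bsub>tensor3 K H\<^esub> comult_id K H (F \<otimes>\<^bsub>tensor2 K H\<^esub> G)
    = tensor2_23 K H (F \<otimes>\<^bsub>tensor2 K H\<^esub> G) \<otimes>\<^bsub>tensor3 K H\<^esub> id_comult K H (F \<otimes>\<^bsub>tensor2 K H\<^esub> G)"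
    using Fc Gc
    by (simp add: tensor2_12_mult tensor2_23_mult ring_hom_mult[OF comult_id_ring_hom]
        ring_hom_mult[OF id_comult_ring_hom] swap left right F12c F23c G12c G23c L R eqF eqG)
  moreover have "F \<otimes>\<^bsub>tensor2 K H\<^esub> G \<in> Units (tensor2 K H)"
    using F G by (simp add: twisting_element_def)
  \<comment> \<open>The counit conditions follow because \<epsilon> \<otimes> id and id \<otimes>
    \<epsilon> are multiplicative and send both factors to 1.\<close>
  ultimately show ?thesis
    using F G Fc Gc
    by (simp add: twisting_element_def twist_equations_def ring_hom_mult[OF counit_id_ring_hom]
        ring_hom_mult[OF id_counit_ring_hom])
qed

text \<open>The restricted ring has the product and unit of H \<otimes> H and its elements lie
  there, so an inverse in S \<otimes> S is an inverse in H \<otimes> H; the twist equations are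
  already those of \<open>H\<close>.\<close>

lemma twisting_element_of_subD:
  assumes F: "twisting_element_of_sub K H S F" and S: "subgroup S (add_monoid H)"
  shows "twisting_element K H F \<and> F \<in> tensor_subspace K H H S S"
proof -
  \<comment> \<open>Induction with the constantly true predicate extracts membership in the
    carrier.\<close>
  have "X \<in> carrier (tensor2 K H)" if "X \<in> tensor_subspace K H H S S" for X
    using T2.tensor_subspace_induct[OF that S S, of "\<lambda>_. True"] by simp
  then show ?thesis
    using F by (auto simp: twisting_element_of_sub_def twisting_element_def Units_def)
qed

end

theorem proposition2:
  fixes K :: "('k, 'r) ring_scheme"
    and H :: "('k, 'a, 's) hopf_scheme"
    and A B :: "nat \<Rightarrow> 'a set"
    and F :: "nat \<Rightarrow> ('a \<times> 'a \<Rightarrow>\<^sub>0 int) set"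
    and p :: nat
  assumes hopf: "hopf_algebra K H"
    and A_zero: "A 0 = carrier H"
    and A_sub: "\<And>k. k \<le> p \<Longrightarrow> hopf_subalgebra K H (A k)"
    and A_chain: "\<And>k. k < p \<Longrightarrow> A (Suc k) \<subseteq> A k"
    and B_sub: "\<And>k. k \<le> p \<Longrightarrow> B k \<subseteq> A k"
    and B_carrier: "\<And>k. k \<le> p \<Longrightarrow> carrier_of_twist K H (B k) (F k)"
    and commute: "\<And>k a. \<lbrakk>k < p; a \<in> A (Suc k)\<rbrakk> \<Longrightarrow>
      F k \<otimes>\<^bsub>tensor2 K H\<^esub> comult H a = comult H a \<otimes>\<^bsub>tensor2 K H\<^esub> F k"
  shows "\<forall>k\<le>p. twisting_element K H (twist_product K H F k)"
proof -
  interpret hopf_algebra K H by (rule hopf)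
  have B_subgroup: "subgroup (B k) (add_monoid H)" if "k \<le> p" for k
    using B_carrier[OF that] by (simp add: carrier_of_twist_def hopf_subalgebra_def subring_def)
  have F: "twisting_element K H (F k)" "F k \<in> tensor_subspace K H H (B k) (B k)" if "k \<le> p" for k
    using twisting_element_of_subD[OF _ B_subgroup[OF that]] B_carrier[OF that]
    by (auto simp: carrier_of_twist_def)
  have Fc: "F k \<in> carrier (tensor2 K H)" if "k \<le> p" for k
    using F(1)[OF that] R2.Units_closed by (auto simp: twisting_element_def)
  have A_carrier: "A k \<subseteq> carrier H" if "k \<le> p" for k
    using subringE(1) A_sub[OF that] by (auto simp: hopf_subalgebra_def)
  \<comment> \<open>The induction also carries commutation of the partial product with \<Delta>(A
    (Suc k)), which the next step consumes. The guard \<open>k < p\<close> keeps the index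
    \<open>Suc k\<close> within the chain.\<close>
  have "twisting_element K H (twist_product K H F k) \<and>
      (k < p \<longrightarrow> (\<forall>a\<in>A (Suc k). twist_product K H F k \<otimes>\<^bsub>tensor2 K H\<^esub> comult H a
        = comult H a \<otimes>\<^bsub>tensor2 K H\<^esub> twist_product K H F k))" if "k \<le> p" for k
    using that
  proof (induction k)
    case 0
    then show ?case using F(1) commute by auto
  next
    case (Suc k)
    let ?G = "twist_product K H F k"
    from Suc have G: "twisting_element K H ?G" by simp
    \<comment> \<open>\<open>Suc k \<le> p\<close> gives \<open>k < p\<close>, so the guarded half
      of the induction hypothesis is available.\<close>
    from Suc have comm: "?G \<otimes>\<^bsub>tensor2 K H\<^esub> comult H a = comult H a \<otimes>\<^bsub>tensor2 K H\<^esub> ?G" if "a \<in> A (Suc k)" for a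
      using that by auto
    have Gc: "?G \<in> carrier (tensor2 K H)"
      using G R2.Units_closed by (auto simp: twisting_element_def)
    \<comment> \<open>Here \<open>S\<close> is \<open>B (Suc k)\<close>; its elements lie in
      \<open>A (Suc k)\<close>, where \<open>comm\<close> applies.\<close>
    have "twisting_element K H (F (Suc k) \<otimes>\<^bsub>tensor2 K H\<^esub> ?G)"
      using B_sub[OF Suc.prems]
      by (intro twisting_element_mult[OF F(1) G F(2) B_subgroup] comm) (use Suc.prems in auto)
    moreover have "(F (Suc k) \<otimes>\<^bsub>tensor2 K H\<^esub> ?G) \<otimes>\<^bsub>tensor2 K H\<^esub> comult H a
        = comult H a \<otimes>\<^bsub>tensor2 K H\<^esub> (F (Suc k) \<otimes>\<^bsub>tensor2 K H\<^esub> ?G)"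
      if "Suc k < p" "a \<in> A (Suc (Suc k))" for a
    proof -
      \<comment> \<open>The chain places \<open>a\<close> where \<open>comm\<close> moves
        \<Delta>(a) past the old product; the hypothesis \<open>commute\<close> at index
        \<open>Suc k\<close> then moves it past the new factor.\<close>
      have a: "a \<in> A (Suc k)" using A_chain[OF that(1)] that(2) by blast
      then have "comult H a \<in> carrier (tensor2 K H)"
        using A_carrier[OF Suc.prems] by (auto intro: comult_closed)
      then show ?thesis
        using Gc Fc[OF Suc.prems] comm[OF a] commute[OF that] by (metis R2.m_assoc)
    qed
    ultimately show ?case by simp
  qed
  then show ?thesis by blast
qed

end
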